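(* Let $\mu>0$ and $\Lambda\geq0$, and let $\widetilde{W}_{\mathrm H}\colon\mathrm{GL}^+(n)\to\mathbb{R}$ be the function $$\widetilde{W}_{\mathrm H}(F) = \mu\left(\sum_{i=1}^n \varphi_{1/3}(\lambda_i) - \frac43\,\ln(\det F)\right) + \psi(\det F),$$ where $\lambda_1,\dots,\lambda_n$ are the singular values of $F$, $$\varphi_{1/3}(\lambda)=\begin{cases} -\frac49 & \text{if } \lambda\leq e^{-2/3},\\ \ln^2(\lambda)+\frac43\ln(\lambda) & \text{if } e^{-2/3}<\lambda<e^{1/3},\\ \frac59 + \frac{2}{e^{1/3}}\left(e^{\lambda-e^{1/3}}-1\right) & \text{if } e^{1/3}\leq\lambda, \end{cases} \qquad \psi(t) = \begin{cases} \frac{\Lambda}{2}\ln^2(t) & \text{if } 0<t\leq e,\\ \frac{\Lambda}{2} + \frac{\Lambda}{e}\left(e^{t-e}-1\right) & \text{if } t>e, \end{cases}$$ constructed as a polyconvex extension of the quadratic Hencky energy. Then $\widetilde{W}_{\mathrm H}$ is unconditionally coercive, i.e. for any $p>0$ there exist constants $K_1,K_2>0$ such that $$\widetilde{W}_{\mathrm H}(F) \geq K_1\,\|F\|^p - K_2\qquad\text{for all } F\in\mathrm{GL}^+(n).$$ In particular, for each bounded, connected, open set $\Omega\subset\mathbb{R}^n$ with Lipschitz boundary and any $p\geq1$, the energy functional $$I(\varphi) = \int_\Omega \widetilde{W}_{\mathrm H}(\nabla\varphi(x))\,\mathrm{d}x,\qquad \varphi\in W^{1,p}(\Omega;\mathbb{R}^n),$$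 is coercive in the Sobolev space $W^{1,p}(\Omega)$.
   Context: $n$ is the (arbitrary) dimension, $\mathrm{GL}^+(n)$ is the set of real $n\times n$ matrices with positive determinant and $\|\cdot\|$ is the Frobenius norm. The quadratic Hencky energy is $W_{\mathrm H}(F)=\mu\,\|\log\sqrt{F^TF}\|^2+\frac{\Lambda}{2}[\mathrm{tr}(\log\sqrt{F^TF})]^2$, with $\log$ the principal matrix logarithm, $\mu$ the shear modulus and $\Lambda$ the first Lamé parameter; $\widetilde{W}_{\mathrm H}$ is constructed as a polyconvex extension to $\mathrm{GL}^+(n)$ of its restriction to the set of all $F\in\mathrm{GL}^+(n)$ whose singular values all lie in $(e^{-2/3},e^{1/3})$. For the energy functional, $\widetilde{W}_{\mathrm H}$ is extended by the value $+\infty$ to matrices with $\det F\le 0$, so that $I$ takes values in $\mathbb{R}\cup\{+\infty\}$. Coercivity of $I$ is meant in the sense used in the direct methods of the calculus of variations: there exist constants $c_1>0$ and $c_2\in\mathbb{R}$ such that $I(\varphi)\geq c_1\|\nabla\varphi\|_{L^p(\Omega)}^p-c_2$ for all $\varphi\in W^{1,p}(\Omega;\mathbb{R}^n)$. *)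

theory Defs
  imports "HOL-Analysis.Analysis" "HOL-Computational_Algebra.Polynomial"
begin

section \<open>Singular values and the energy density\<close>

definition GL_plus :: "(real^'n^'n) set" where
  "GL_plus = {F. det F > 0}"

text \<open>The determinant is taken over the ring of real polynomials; this is \<open>det (X - A)\<close>.\<close>

definition charpoly :: "real^'n^'n \<Rightarrow> real poly" where
  "charpoly A = det (\<chi> i j. (if i = j then [:0, 1:] else 0) - [:A $ i $ j:])"

text \<open>Square roots of the eigenvalues of \<open>F\<^sup>T F\<close>, counted with multiplicity.\<close>

definition singular_values :: "real^'n^'n \<Rightarrow> real multiset" where
  "singular_values F = image_mset sqrt (proots (charpoly (transpose F ** F)))"

definition hencky_phi :: "real \<Rightarrow> real" where
  "hencky_phi x =
    (if x \<le> exp (- 2/3) then - 4/9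
     else if x < exp (1/3) then (ln x)\<^sup>2 + 4/3 * ln x
     else 5/9 + 2 / exp (1/3) * (exp (x - exp (1/3)) - 1))"

text \<open>Only the values at \<open>t > 0\<close> are meaningful.\<close>

definition hencky_psi :: "real \<Rightarrow> real \<Rightarrow> real" where
  "hencky_psi \<Lambda> t =
    (if t \<le> exp 1 then \<Lambda>/2 * (ln t)\<^sup>2
     else \<Lambda>/2 + \<Lambda> / exp 1 * (exp (t - exp 1) - 1))"

text \<open>Only the values on \<^const>\<open>GL_plus\<close> are meaningful.\<close>

definition W_hencky :: "real \<Rightarrow> real \<Rightarrow> real^'n^'n \<Rightarrow> real" where
  "W_hencky \<mu> \<Lambda> F =
    \<mu> * ((\<Sum>s\<in>#singular_values F. hencky_phi s) - 4/3 * ln (det F)) + hencky_psi \<Lambda> (det F)"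

definition W_hencky_ext :: "real \<Rightarrow> real \<Rightarrow> real^'n^'n \<Rightarrow> ereal" where
  "W_hencky_ext \<mu> \<Lambda> F = (if F \<in> GL_plus then ereal (W_hencky \<mu> \<Lambda> F) else \<infinity>)"


section \<open>Domains with Lipschitz boundary\<close>

text \<open>
  Near every boundary point the set is the region above the graph of a Lipschitz function, in
  the direction of a unit vector \<open>e\<close>. The function \<open>g\<close> lives on the hyperplane orthogonal
  to \<open>e\<close>, which plays the role of the first \<open>n - 1\<close> coordinates after a rotation of the axes.
\<close>

definition lipschitz_boundary :: "'a::euclidean_space set \<Rightarrow> bool" where
  "lipschitz_boundary \<Omega> \<longleftrightarrow>
    (\<forall>x\<in>frontier \<Omega>. \<exists>r>0. \<exists>e C g. norm e = 1 \<and> C-lipschitz_on {y. y \<bullet> e = 0} g \<and>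
       \<Omega> \<inter> ball x r = {y \<in> ball x r. y \<bullet> e > g (y - (y \<bullet> e) *\<^sub>R e)})"


section \<open>Sobolev spaces\<close>

primrec continuously_differentiable :: "nat \<Rightarrow> ('a::euclidean_space \<Rightarrow> real) \<Rightarrow> bool" where
  "continuously_differentiable 0 f \<longleftrightarrow> continuous_on UNIV f"
| "continuously_differentiable (Suc k) f \<longleftrightarrow>
     (\<forall>x. f differentiable (at x)) \<and>
     (\<forall>b\<in>Basis. continuously_differentiable k (\<lambda>x. frechet_derivative f (at x) b))"

definition test_functions :: "'a::euclidean_space set \<Rightarrow> ('a \<Rightarrow> real) set" where
  "test_functions \<Omega> =
    {\<eta>. (\<forall>k. continuously_differentiable k \<eta>) \<and>
        compact (closure {x. \<eta> x \<noteq> 0}) \<and> closure {x. \<eta> x \<noteq> 0} \<subseteq> \<Omega>}"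

definition locally_integrable ::
    "'a::euclidean_space set \<Rightarrow> ('a \<Rightarrow> 'b::euclidean_space) \<Rightarrow> bool" where
  "locally_integrable \<Omega> f \<longleftrightarrow> (\<forall>K. compact K \<and> K \<subseteq> \<Omega> \<longrightarrow> integrable (lebesgue_on K) f)"

text \<open>The entry \<open>G x $ i $ j\<close> is the weak derivative of \<open>u\<^sub>i\<close> in direction \<open>j\<close>.\<close>

definition has_weak_gradient ::
    "(real^'n) set \<Rightarrow> (real^'n \<Rightarrow> real^'m) \<Rightarrow> (real^'n \<Rightarrow> real^'n^'m) \<Rightarrow> bool" where
  "has_weak_gradient \<Omega> u G \<longleftrightarrow>
    locally_integrable \<Omega> u \<and> locally_integrable \<Omega> G \<and>
    (\<forall>\<eta>\<in>test_functions \<Omega>. \<forall>i j.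
       (LINT x|lebesgue_on \<Omega>. u x $ i * frechet_derivative \<eta> (at x) (axis j 1)) =
       - (LINT x|lebesgue_on \<Omega>. G x $ i $ j * \<eta> x))"

text \<open>The weak gradient is unique up to null sets; an arbitrary representative is chosen.\<close>

definition weak_gradient ::
    "(real^'n) set \<Rightarrow> (real^'n \<Rightarrow> real^'m) \<Rightarrow> real^'n \<Rightarrow> real^'n^'m" where
  "weak_gradient \<Omega> u = (SOME G. has_weak_gradient \<Omega> u G)"

definition Lp_space :: "real \<Rightarrow> 'a measure \<Rightarrow> ('a \<Rightarrow> 'b::euclidean_space) set" where
  "Lp_space p M = {f \<in> borel_measurable M. integrable M (\<lambda>x. norm (f x) powr p)}"

definition Lp_norm :: "real \<Rightarrow> 'a measure \<Rightarrow> ('a \<Rightarrow> 'b::euclidean_space) \<Rightarrow> real" where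
  "Lp_norm p M f = (LINT x|M. norm (f x) powr p) powr (1 / p)"

text \<open>Elements are functions rather than classes modulo equality almost everywhere.\<close>

definition W1p_space :: "real \<Rightarrow> (real^'n) set \<Rightarrow> (real^'n \<Rightarrow> real^'m) set" where
  "W1p_space p \<Omega> =
    {u \<in> Lp_space p (lebesgue_on \<Omega>).
      \<exists>G \<in> Lp_space p (lebesgue_on \<Omega>). has_weak_gradient \<Omega> u G}"


section \<open>The energy functional and coercivity\<close>

text \<open>
  Lebesgue integral of an extended real function as the difference of the integrals of its
  positive and negative part; \<^const>\<open>e2ennreal\<close> maps negative numbers to \<open>0\<close>. The value is
  meaningful if one of the two integrals is finite. For the energy below this is always the
  case, since the density is bounded below and the domain has finite measure.
\<close>

definition ereal_integral :: "'a measure \<Rightarrow> ('a \<Rightarrow> ereal) \<Rightarrow> ereal" where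
  "ereal_integral M f =
    enn2ereal (\<integral>\<^sup>+x. e2ennreal (f x) \<partial>M) - enn2ereal (\<integral>\<^sup>+x. e2ennreal (- f x) \<partial>M)"

definition hencky_energy ::
    "real \<Rightarrow> real \<Rightarrow> (real^'n) set \<Rightarrow> (real^'n \<Rightarrow> real^'n) \<Rightarrow> ereal" where
  "hencky_energy \<mu> \<Lambda> \<Omega> u =
    ereal_integral (lebesgue_on \<Omega>) (\<lambda>x. W_hencky_ext \<mu> \<Lambda> (weak_gradient \<Omega> u x))"

definition coercive_W1p ::
    "real \<Rightarrow> (real^'n) set \<Rightarrow> ((real^'n \<Rightarrow> real^'m) \<Rightarrow> ereal) \<Rightarrow> bool" where
  "coercive_W1p p \<Omega> I \<longleftrightarrow>
    (\<exists>c\<^sub>1>0. \<exists>c\<^sub>2. \<forall>u\<in>W1p_space p \<Omega>.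
       I u \<ge> ereal (c\<^sub>1 * Lp_norm p (lebesgue_on \<Omega>) (weak_gradient \<Omega> u) powr p - c\<^sub>2))"

end

theory Submission
  imports Defs "HOL-Real_Asymp.Real_Asymp"
begin

text \<open>
  The sum over the singular values dominates \<open>c exp s - C\<close> for the largest singular value \<open>s\<close>,
  since \<^const>\<open>hencky_phi\<close> is bounded below and grows exponentially. As \<open>\<parallel>F\<parallel> \<le> \<surd>n s\<close>, this is
  exponential in \<open>\<parallel>F\<parallel>\<close>, whereas \<open>ln (det F)\<close> is at most linear in \<open>\<parallel>F\<parallel>\<close> and
  \<^const>\<open>hencky_psi\<close> is nonnegative. Of the spectral theory of \<open>F\<^sup>T F\<close> only its largest eigenvalue
  is needed: it is the maximum of \<open>\<parallel>F x\<parallel>\<^sup>2\<close> over the unit sphere.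
\<close>

section \<open>Determinants and the characteristic polynomial\<close>

text \<open>Leibniz expansion: there are n! signed products of n entries, and each entry is at most
  the Frobenius norm. The crude factor n! only adds a constant after taking logarithms.\<close>

lemma abs_det_le_fact_norm_power:
  fixes A :: "real^'n^'n"
  shows "\<bar>det A\<bar> \<le> fact CARD('n) * norm A ^ CARD('n)"
proof -
  have entry: "\<bar>A $ i $ j\<bar> \<le> norm A" for i j
    using component_le_norm_cart[of "A $ i" j] Finite_Cartesian_Product.norm_nth_le[of A i] by simp
  have "\<bar>det A\<bar> \<le> (\<Sum>p | p permutes (UNIV :: 'n set). norm A ^ CARD('n))"
    unfolding det_def
  proof (rule order_trans[OF sum_abs], rule sum_mono)
    fix p
    have "\<bar>\<Prod>i\<in>UNIV. A $ i $ p i\<bar> \<le> (\<Prod>i\<in>(UNIV :: 'n set). norm A)"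
      unfolding abs_prod by (rule prod_mono) (use entry in auto)
    then show "\<bar>of_int (sign p) * (\<Prod>i\<in>UNIV. A $ i $ p i)\<bar> \<le> norm A ^ CARD('n)"
      by (simp add: abs_mult sign_def)
  qed
  also have "\<dots> = fact CARD('n) * norm A ^ CARD('n)"
    by (simp add: card_permutations[of UNIV "CARD('n)"])
  finally show ?thesis .
qed

lemma poly_charpoly:
  fixes A :: "real^'n^'n"
  shows "poly (charpoly A) t = det (mat t - A)"
  unfolding charpoly_def det_def poly_sum poly_mult poly_prod
  by (intro sum.cong prod.cong arg_cong2[where f = "(*)"] refl) (auto simp: mat_def)

lemma degree_charpoly_le:
  fixes A :: "real^'n^'n"
  shows "degree (charpoly A) \<le> CARD('n)"
  unfolding charpoly_def det_def
proof (rule degree_sum_le, goal_cases)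
  case 1
  show ?case by (simp add: finite_permutations)
next
  case (2 p)
  let ?M = "(\<chi> i j. (if i = j then [:0, 1:] else 0) - [:A $ i $ j:]) :: real poly^'n^'n"
  have "degree (\<Prod>i\<in>UNIV. ?M $ i $ p i) \<le> (\<Sum>i\<in>(UNIV :: 'n set). degree (?M $ i $ p i))"
    using degree_prod_sum_le[of UNIV "\<lambda>i. ?M $ i $ p i"] by (simp add: o_def)
  also have "\<dots> \<le> (\<Sum>i\<in>(UNIV :: 'n set). 1)"
    by (intro sum_mono) auto
  finally show ?case
    using degree_mult_le[of "of_int (sign p)" "\<Prod>i\<in>UNIV. ?M $ i $ p i"] by simp
qed

lemma det_eq_0_iff_kernel:
  fixes A :: "real^'n^'n"
  shows "det A = 0 \<longleftrightarrow> (\<exists>x. x \<noteq> 0 \<and> A *v x = 0)"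
  by (metis invertible_det_nz invertible_left_inverse matrix_left_invertible_ker)

lemma inner_gram:
  fixes F :: "real^'n^'m"
  shows "((transpose F ** F) *v x) \<bullet> y = (F *v x) \<bullet> (F *v y)"
  by (simp add: dot_lmul_matrix flip: matrix_vector_mul_assoc)

text \<open>A Gram matrix is positive semidefinite, so -1 is not an eigenvalue. Nonvanishing is what
  makes membership in \<open>proots\<close> the same as being a root.\<close>

lemma charpoly_gram_nonzero:
  fixes F :: "real^'n^'n"
  shows "charpoly (transpose F ** F) \<noteq> 0"
proof
  assume "charpoly (transpose F ** F) = 0"
  then have "det (mat (-1) - transpose F ** F) = 0"
    using poly_charpoly[of "transpose F ** F" "-1"] by simp
  then obtain x where x: "x \<noteq> 0" "(mat (-1) - transpose F ** F) *v x = 0"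
    unfolding det_eq_0_iff_kernel by blast
  have "mat (-1) *v x = - x"
    by (simp add: vec_eq_iff matrix_vector_mult_def mat_def if_distrib[where f = "\<lambda>a. a * _"] cong: if_cong)
  then have "- x = (transpose F ** F) *v x"
    using x(2) by (simp add: matrix_vector_mult_diff_rdistrib)
  then have "- (x \<bullet> x) = (F *v x) \<bullet> (F *v x)"
    by (metis inner_gram inner_minus_left)
  then show False
    using x(1) by (metis inner_ge_zero inner_gt_zero_iff neg_0_le_iff_le not_le)
qed

section \<open>The largest singular value\<close>

text \<open>The first-order condition at the minimum \<open>t = 0\<close>, in algebraic
  form.\<close>

lemma linear_term_zero_of_nonneg:
  fixes a b :: real
  assumes "\<And>t. 0 \<le> a * t + b * t\<^sup>2"
  shows "a = 0"
proof -
  \<comment> \<open>A step against the slope; as the denominator exceeds \<open>b\<close>, the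
    linear term outweighs the quadratic one unless \<open>a = 0\<close>.\<close>
  define t where "t = - a / (\<bar>b\<bar> + 1)"
  have nz: "\<bar>b\<bar> + 1 \<noteq> 0" by simp
  then have "a * t + b * t\<^sup>2 = - a\<^sup>2 * (\<bar>b\<bar> + 1 - b) / (\<bar>b\<bar> + 1)\<^sup>2"
    unfolding t_def by (simp add: divide_simps power2_eq_square) algebra
  with assms[of t] have "0 \<le> - a\<^sup>2 * (\<bar>b\<bar> + 1 - b) / (\<bar>b\<bar> + 1)\<^sup>2" by simp
  then have "a\<^sup>2 * (\<bar>b\<bar> + 1 - b) \<le> 0"
    using nz by (simp add: divide_le_0_iff)
  moreover have "\<bar>b\<bar> + 1 - b > 0" by simp
  ultimately show ?thesis
    by (simp add: mult_le_0_iff)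
qed

text \<open>The vector \<open>v\<close> maximises the norm of \<open>F *v x\<close> on the compact
  unit sphere; the eigenvector equation is the first-order condition along the lines
  \<open>v + t *\<^sub>R w\<close>.\<close>

lemma gram_max_eigenvector:
  fixes F :: "real^'n^'n"
  obtains v m where "norm v = 1" "(transpose F ** F) *v v = m *\<^sub>R v"
    "\<And>x. (norm (F *v x))\<^sup>2 \<le> m * (norm x)\<^sup>2"
proof -
  have "\<exists>v\<in>sphere (0 :: real^'n) 1. \<forall>x\<in>sphere 0 1. norm (F *v x) \<le> norm (F *v v)"
    by (rule continuous_attains_sup) (auto intro!: continuous_intros)
  then obtain v where v: "norm v = 1" "\<And>x. norm x = 1 \<Longrightarrow> norm (F *v x) \<le> norm (F *v v)"
    by auto
  define m where "m = (norm (F *v v))\<^sup>2"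
  have max: "(norm (F *v x))\<^sup>2 \<le> m * (norm x)\<^sup>2" for x
  proof (cases "x = 0")
    case False
    have "F *v x = norm x *\<^sub>R (F *v ((1 / norm x) *\<^sub>R x))"
      using False by (simp add: matrix_vector_mult_scaleR)
    then have "norm (F *v x) = norm x * norm (F *v ((1 / norm x) *\<^sub>R x))"
      by (metis norm_scaleR abs_norm_cancel)
    also have "\<dots> \<le> norm x * norm (F *v v)"
      using False by (intro mult_left_mono v(2)) auto
    finally have "(norm (F *v x))\<^sup>2 \<le> (norm x * norm (F *v v))\<^sup>2"
      by (intro power_mono) auto
    then show ?thesis by (simp add: m_def power_mult_distrib mult.commute)
  qed simp
  have "(m *\<^sub>R v - (transpose F ** F) *v v) \<bullet> w = 0" for w
  proof -
    \<comment> \<open>This is the gap in the maximum inequality at \<open>v + t *\<^sub>R w\<close>,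
      expanded in \<open>t\<close>; its constant term vanishes because \<open>v\<close> attains
      equality.\<close>
    have "0 \<le> (2 * (m * (v \<bullet> w) - (F *v v) \<bullet> (F *v w))) * t + (m * (w \<bullet> w) - (F *v w) \<bullet> (F *v w)) * t\<^sup>2"
      for t
    proof -
      have "(F *v (v + t *\<^sub>R w)) \<bullet> (F *v (v + t *\<^sub>R w)) \<le> m * ((v + t *\<^sub>R w) \<bullet> (v + t *\<^sub>R w))"
        using max[of "v + t *\<^sub>R w"] by (simp add: power2_norm_eq_inner)
      moreover have "(F *v v) \<bullet> (F *v v) = m * (v \<bullet> v)"
        using v(1) by (simp add: m_def power2_norm_eq_inner norm_eq_1)
      ultimately show ?thesis
        by (simp add: matrix_vector_right_distrib matrix_vector_mult_scaleR inner_simps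
            inner_commute[of w v] inner_commute[of "F *v w" "F *v v"] power2_eq_square algebra_simps)
    qed
    from linear_term_zero_of_nonneg[OF this] show ?thesis
      by (simp add: inner_diff_left inner_gram)
  qed
  then have "m *\<^sub>R v - (transpose F ** F) *v v = 0"
    using inner_eq_zero_iff by blast
  then show ?thesis
    using that[of v m] v(1) max by simp
qed

lemma norm_power2_eq_sum_columns:
  fixes F :: "real^'n^'m"
  shows "(norm F)\<^sup>2 = (\<Sum>j\<in>UNIV. (norm (F *v axis j 1))\<^sup>2)"
proof -
  have "(norm F)\<^sup>2 = (\<Sum>i\<in>UNIV. \<Sum>j\<in>UNIV. (F $ i $ j)\<^sup>2)"
    unfolding power2_norm_eq_inner inner_vec_def by (simp add: power2_eq_square)
  also have "\<dots> = (\<Sum>j\<in>UNIV. \<Sum>i\<in>UNIV. (F $ i $ j)\<^sup>2)"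
    by (rule sum.swap)
  also have "\<dots> = (\<Sum>j\<in>UNIV. (norm (F *v axis j 1))\<^sup>2)"
    unfolding power2_norm_eq_inner
    by (simp add: matrix_vector_mult_basis column_def inner_vec_def power2_eq_square)
  finally show ?thesis .
qed

text \<open>The eigenvalue \<open>m\<close> of \<open>gram_max_eigenvector\<close> is a root of the
  characteristic polynomial, and each of the n columns of \<open>F\<close> has squared length at
  most \<open>m\<close>.\<close>

lemma large_singular_value:
  fixes F :: "real^'n^'n"
  obtains s where "s \<in># singular_values F" "norm F \<le> sqrt CARD('n) * s"
proof -
  obtain v m where v: "norm v = 1" "(transpose F ** F) *v v = m *\<^sub>R v"
    and max: "\<And>x. (norm (F *v x))\<^sup>2 \<le> m * (norm x)\<^sup>2"
    using gram_max_eigenvector[of F] by blast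
  have "(mat m :: real^'n^'n) *v v = m *\<^sub>R v"
    by (simp add: vec_eq_iff matrix_vector_mult_def mat_def if_distrib[where f = "\<lambda>a. a * _"] cong: if_cong)
  then have "(mat m - transpose F ** F) *v v = 0"
    using v(2) by (simp add: matrix_vector_mult_diff_rdistrib)
  moreover have "v \<noteq> 0" using v(1) by auto
  ultimately have "poly (charpoly (transpose F ** F)) m = 0"
    unfolding poly_charpoly det_eq_0_iff_kernel by blast
  then have "sqrt m \<in># singular_values F"
    by (simp add: singular_values_def charpoly_gram_nonzero)
  moreover have "(norm F)\<^sup>2 \<le> (\<Sum>j\<in>(UNIV :: 'n set). m)"
    unfolding norm_power2_eq_sum_columns
    by (rule sum_mono) (metis max norm_axis_1 mult.right_neutral one_power2)
  then have "norm F \<le> sqrt CARD('n) * sqrt m"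
    by (simp add: real_le_rsqrt flip: real_sqrt_mult)
  ultimately show ?thesis using that by blast
qed

lemma size_singular_values_le:
  fixes F :: "real^'n^'n"
  shows "size (singular_values F) \<le> CARD('n)"
  unfolding singular_values_def
  using size_proots_le degree_charpoly_le order_trans by (metis size_image_mset)

section \<open>Growth of the energy density\<close>

lemma hencky_phi_ge: "hencky_phi x \<ge> - 4/9"
proof -
  \<comment> \<open>Completing the square handles the middle branch.\<close>
  have "(ln x)\<^sup>2 + 4/3 * ln x = (ln x + 2/3)\<^sup>2 - 4/9"
    by (simp add: power2_eq_square algebra_simps)
  moreover have "exp (x - exp (1/3)) \<ge> 1" if "x \<ge> exp (1/3)"
    using that by simp
  ultimately show ?thesis
    by (auto simp: hencky_phi_def intro: order_trans[of _ "5/9"])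
qed

text \<open>One exponential bound for all branches: left of \<open>exp (1/3)\<close> the exponential
  term is nonpositive and \<open>hencky_phi_ge\<close> takes over.\<close>

lemma hencky_phi_ge_exp:
  "hencky_phi x \<ge> 2 / exp (1/3) * (exp (x - exp (1/3)) - 1) - 4/9"
proof (cases "x < exp (1/3)")
  case True
  then have "2 / exp (1/3) * (exp (x - exp (1/3)) - 1) \<le> 0"
    by (intro mult_nonneg_nonpos) auto
  with hencky_phi_ge[of x] show ?thesis by linarith
next
  case False
  moreover have "exp (- 2/3) < exp (1/3 :: real)" by simp
  ultimately have "\<not> x \<le> exp (- 2/3)" by linarith
  with False show ?thesis by (simp add: hencky_phi_def)
qed

lemma hencky_psi_nonneg: "\<Lambda> \<ge> 0 \<Longrightarrow> hencky_psi \<Lambda> t \<ge> 0"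
  by (auto simp: hencky_psi_def)

text \<open>Isolates the largest singular value; every other term costs at most
  \<open>c\<close>.\<close>

lemma sum_mset_ge_member:
  fixes f :: "'a \<Rightarrow> real"
  assumes "s \<in># M" "\<And>x. f x \<ge> - c" "c \<ge> 0" "size M \<le> n"
  shows "(\<Sum>x\<in>#M. f x) \<ge> f s - c * n"
proof -
  have lower: "(\<Sum>x\<in>#N. f x) \<ge> - c * size N" for N
  proof (induction N)
    case (add x N)
    then show ?case using assms(2)[of x] by (simp add: algebra_simps)
  qed simp
  obtain N where N: "M = add_mset s N" using assms(1) by (metis insert_DiffM)
  have "c * size N \<le> c * n"
    using assms(3,4) N by (intro mult_left_mono) auto
  then show ?thesis using lower[of N] N by simp
qed

lemma W_hencky_ge_exp:
  fixes \<mu> \<Lambda> :: real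
  assumes "\<mu> > 0" "\<Lambda> \<ge> 0"
  obtains a b d C where "a > 0" "b > 0"
    "\<And>F :: real^'n^'n. F \<in> GL_plus \<Longrightarrow> W_hencky \<mu> \<Lambda> F \<ge> a * exp (b * norm F) - d * norm F - C"
proof -
  let ?n = "CARD('n)"
  define e where "e = exp (1/3 :: real)"
  \<comment> \<open>In order: the constants of \<open>hencky_phi_ge_exp\<close>, the cost of the
    other singular values, and the factorial from the determinant bound.\<close>
  define C0 where "C0 = 2 / e + 4/9 + 4/9 * ?n + 4/3 * ln (fact ?n)"
  have "W_hencky \<mu> \<Lambda> F \<ge> \<mu> * (2 / e * exp (- e)) * exp (1 / sqrt ?n * norm F)
      - (\<mu> * (4/3 * ?n)) * norm F - \<mu> * C0"
    if F: "F \<in> GL_plus" for F :: "real^'n^'n"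
  proof -
    have det: "det F > 0" using F by (simp add: GL_plus_def)
    have pos: "norm F > 0"
    proof -
      have "F \<noteq> 0"
        using det by (metis det_eq_0_iff_kernel less_irrefl matrix_vector_mult_0
            axis_eq_0_iff zero_neq_one)
      then show ?thesis by simp
    qed
    obtain s where s: "s \<in># singular_values F" "norm F \<le> sqrt ?n * s"
      using large_singular_value .
    have "1 / sqrt ?n * norm F \<le> s"
      using s(2) by (simp add: field_simps)
    then have "2 / e * exp (- e) * exp (1 / sqrt ?n * norm F) \<le> 2 / e * exp (- e) * exp s"
      by (intro mult_left_mono) (auto simp: e_def)
    also have "\<dots> = 2 / e * (exp (s - e) - 1) - 4/9 + (2 / e + 4/9)"
    proof -
      have "exp (s - e) = exp (- e) * exp s" by (simp flip: exp_add)
      then show ?thesis by (simp only: right_diff_distrib)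
    qed
    also have "\<dots> \<le> hencky_phi s + (2 / e + 4/9)"
      using hencky_phi_ge_exp[of s] by (simp add: e_def)
    finally have phi: "2 / e * exp (- e) * exp (1 / sqrt ?n * norm F) \<le> hencky_phi s + (2 / e + 4/9)" .
    have sum: "(\<Sum>s\<in>#singular_values F. hencky_phi s) \<ge> hencky_phi s - 4/9 * ?n"
      by (rule sum_mset_ge_member) (use s hencky_phi_ge size_singular_values_le in auto)
    have "ln (det F) \<le> ln (fact ?n * norm F ^ ?n)"
      using det abs_det_le_fact_norm_power[of F] by simp
    also have "\<dots> = ln (fact ?n) + ?n * ln (norm F)"
      using pos by (simp add: ln_mult ln_realpow)
    also have "\<dots> \<le> ln (fact ?n) + ?n * norm F"
      using ln_bound[OF pos] by (intro add_left_mono mult_left_mono) auto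
    finally have logdet: "ln (det F) \<le> ln (fact ?n) + ?n * norm F" .
    have "2 / e * exp (- e) * exp (1 / sqrt ?n * norm F) - 4/3 * ?n * norm F - C0
        \<le> (\<Sum>s\<in>#singular_values F. hencky_phi s) - 4/3 * ln (det F)"
      using phi sum logdet unfolding C0_def by argo
    then have "\<mu> * (2 / e * exp (- e) * exp (1 / sqrt ?n * norm F) - 4/3 * ?n * norm F - C0)
        \<le> W_hencky \<mu> \<Lambda> F - hencky_psi \<Lambda> (det F)"
      using assms(1) by (simp add: W_hencky_def)
    then show ?thesis
      using hencky_psi_nonneg[OF assms(2), of "det F"] by (simp add: algebra_simps)
  qed
  moreover have "\<mu> * (2 / e * exp (- e)) > 0" "1 / sqrt ?n > 0"
    using assms(1) by (auto simp: e_def)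
  ultimately show ?thesis using that by blast
qed

lemma powr_plus_linear_le_exp:
  fixes a b d p :: real
  assumes "a > 0" "b > 0" "p > 0"
  obtains C where "C > 0" "\<And>x. x \<ge> 0 \<Longrightarrow> x powr p + d * x \<le> a * exp (b * x) + C"
proof -
  have "eventually (\<lambda>x. x powr p + d * x \<le> a * exp (b * x)) at_top"
    using assms by real_asymp
  then obtain N where N: "\<And>x. x \<ge> N \<Longrightarrow> x powr p + d * x \<le> a * exp (b * x)"
    unfolding eventually_at_top_linorder by blast
  \<comment> \<open>Bounds the left side on the part of the half-line below \<open>N\<close>; the
    absolute values allow for negative \<open>N\<close> or \<open>d\<close>.\<close>
  define C where "C = \<bar>N\<bar> powr p + \<bar>d\<bar> * \<bar>N\<bar> + 1"
  have C: "C > 0" unfolding C_def by (intro add_nonneg_pos add_nonneg_nonneg) auto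
  have "x powr p + d * x \<le> a * exp (b * x) + C" if "x \<ge> 0" for x
  proof (cases "x \<ge> N")
    case True
    with N[of x] C show ?thesis by simp
  next
    case False
    then have "x powr p \<le> \<bar>N\<bar> powr p"
      using that assms by (intro powr_mono2) auto
    moreover have "d * x \<le> \<bar>d\<bar> * \<bar>N\<bar>"
      using that False by (intro mult_mono) auto
    moreover have "a * exp (b * x) > 0" using assms by simp
    ultimately show ?thesis unfolding C_def by argo
  qed
  then show ?thesis using that C by blast
qed

text \<open>Exponential growth absorbs both the power and the linear loss from the logarithm, so the
  leading constant can be 1 for every \<open>p\<close>.\<close>

lemma W_hencky_coercive:
  fixes \<mu> \<Lambda> p :: real
  assumes "\<mu> > 0" "\<Lambda> \<ge> 0" "p > 0"
  obtains K where "K > 0"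
    "\<And>F :: real^'n^'n. F \<in> GL_plus \<Longrightarrow> W_hencky \<mu> \<Lambda> F \<ge> norm F powr p - K"
proof -
  obtain a b d C where ab: "a > 0" "b > 0" and
    W: "\<And>F :: real^'n^'n. F \<in> GL_plus \<Longrightarrow> W_hencky \<mu> \<Lambda> F \<ge> a * exp (b * norm F) - d * norm F - C"
    using W_hencky_ge_exp[OF assms(1,2)] by blast
  obtain D where D: "\<And>x. x \<ge> 0 \<Longrightarrow> x powr p + d * x \<le> a * exp (b * x) + D"
    using powr_plus_linear_le_exp[OF ab assms(3)] by blast
  have "W_hencky \<mu> \<Lambda> F \<ge> norm F powr p - (\<bar>C + D\<bar> + 1)" if "F \<in> GL_plus" for F :: "real^'n^'n"
    using W[OF that] D[of "norm F"] by simp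
  then show ?thesis using that[of "\<bar>C + D\<bar> + 1"] by simp
qed

section \<open>Coercivity of the energy\<close>

text \<open>
  The function \<open>f\<close> need not be measurable: \<^const>\<open>nn_integral\<close> is monotone on arbitrary functions.
\<close>

lemma ereal_integral_ge:
  assumes g: "integrable M g" and le: "\<And>x. x \<in> space M \<Longrightarrow> ereal (g x) \<le> f x"
  shows "ereal (integral\<^sup>L M g) \<le> ereal_integral M f"
proof -
  let ?P = "\<integral>\<^sup>+x. ennreal (g x) \<partial>M" and ?N = "\<integral>\<^sup>+x. ennreal (- g x) \<partial>M"
  have fin: "?P < top" "?N < top"
    using g by (auto simp: real_integrable_def less_top)
  have "?P \<le> (\<integral>\<^sup>+x. e2ennreal (f x) \<partial>M)"
    by (intro nn_integral_mono) (use le e2ennreal_mono in fastforce)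
  moreover have "(\<integral>\<^sup>+x. e2ennreal (- f x) \<partial>M) \<le> ?N"
    by (intro nn_integral_mono) (metis le e2ennreal_mono ereal_minus_le_minus uminus_ereal.simps(1) e2ennreal_ereal)
  \<comment> \<open>Both parts are finite, so the real integral is a genuine difference in
    \<open>ereal\<close>.\<close>
  moreover have "ereal (integral\<^sup>L M g) = enn2ereal ?P - enn2ereal ?N"
  proof -
    have "enn2ereal ?P = ereal (enn2real ?P)" "enn2ereal ?N = ereal (enn2real ?N)"
      using fin by (metis enn2ereal_ennreal enn2real_nonneg ennreal_enn2real)+
    then show ?thesis by (simp add: real_lebesgue_integral_def[OF g])
  qed
  ultimately show ?thesis
    by (simp add: ereal_integral_def ereal_minus_mono less_eq_ennreal.rep_eq)
qed

lemma Lp_norm_powr: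
  assumes "p \<noteq> 0"
  shows "Lp_norm p M f powr p = (LINT x|M. norm (f x) powr p)"
  using assms by (simp add: Lp_norm_def powr_powr)

text \<open>
  \<^const>\<open>weak_gradient\<close> is an arbitrary representative, so that \<open>G\<close> is not assumed to be
  \<open>p\<close>-integrable; if it is not, its \<^const>\<open>Lp_norm\<close> is the junk value \<open>0\<close> and the lower
  bound \<open>- K\<close> of the integrand suffices.
\<close>

lemma ereal_integral_ge_Lp_norm:
  assumes M: "finite_measure M" and p: "p \<noteq> 0"
    and f: "\<And>x. x \<in> space M \<Longrightarrow> ereal (norm (G x) powr p - K) \<le> f x"
  shows "ereal (Lp_norm p M G powr p - K * measure M (space M)) \<le> ereal_integral M f"
proof (cases "integrable M (\<lambda>x. norm (G x) powr p)")
  case True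
  interpret finite_measure M by fact
  have "ereal (LINT x|M. norm (G x) powr p - K) \<le> ereal_integral M f"
    by (rule ereal_integral_ge) (use True f in auto)
  then show ?thesis
    using True by (simp add: Lp_norm_powr[OF p] mult.commute)
next
  case False
  interpret finite_measure M by fact
  have "ereal (- K) \<le> f x" if "x \<in> space M" for x
    by (rule order_trans[OF _ f[OF that]]) simp
  then have "ereal (LINT x|M. - K) \<le> ereal_integral M f"
    by (intro ereal_integral_ge) auto
  then show ?thesis
    using False by (simp add: Lp_norm_powr[OF p] not_integrable_integral_eq mult.commute)
qed

theorem lemma3p6:
  fixes \<mu> \<Lambda> :: real
  assumes "\<mu> > 0" and "\<Lambda> \<ge> 0"
  shows "(\<forall>p::real. p > 0 \<longrightarrow>
            (\<exists>K\<^sub>1>0. \<exists>K\<^sub>2>0. \<forall>F \<in> (GL_plus :: (real^'n^'n) set).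
               W_hencky \<mu> \<Lambda> F \<ge> K\<^sub>1 * norm F powr p - K\<^sub>2)) \<and>
         (\<forall>(\<Omega> :: (real^'n) set) (p::real).
            bounded \<Omega> \<longrightarrow> connected \<Omega> \<longrightarrow> open \<Omega> \<longrightarrow> lipschitz_boundary \<Omega> \<longrightarrow> p \<ge> 1 \<longrightarrow>
            coercive_W1p p \<Omega> (hencky_energy \<mu> \<Lambda> \<Omega>))"
proof (intro conjI allI impI)
  fix p :: real
  assume "p > 0"
  obtain K where "K > 0" "\<And>F :: real^'n^'n. F \<in> GL_plus \<Longrightarrow> W_hencky \<mu> \<Lambda> F \<ge> norm F powr p - K"
    using W_hencky_coercive[OF assms \<open>p > 0\<close>] by blast
  then show "\<exists>K\<^sub>1>0. \<exists>K\<^sub>2>0. \<forall>F \<in> (GL_plus :: (real^'n^'n) set).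
      W_hencky \<mu> \<Lambda> F \<ge> K\<^sub>1 * norm F powr p - K\<^sub>2"
    by (intro exI[of _ 1] exI[of _ K]) auto
next
  fix \<Omega> :: "(real^'n) set" and p :: real
  assume "bounded \<Omega>" "open \<Omega>" "p \<ge> 1"
  then have p: "p > 0" and M: "finite_measure (lebesgue_on \<Omega>)"
    by (auto intro: finite_measure_lebesgue_on lmeasurable_open)
  obtain K where K: "\<And>F :: real^'n^'n. F \<in> GL_plus \<Longrightarrow> W_hencky \<mu> \<Lambda> F \<ge> norm F powr p - K"
    using W_hencky_coercive[OF assms p] by blast
  \<comment> \<open>Outside \<open>GL_plus\<close> the density is infinite, so the bound holds at
    every value of the weak gradient.\<close>
  have "ereal (norm F powr p - K) \<le> W_hencky_ext \<mu> \<Lambda> F" for F :: "real^'n^'n"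
    using K by (simp add: W_hencky_ext_def)
  then have "ereal (Lp_norm p (lebesgue_on \<Omega>) (weak_gradient \<Omega> u) powr p
      - K * measure (lebesgue_on \<Omega>) (space (lebesgue_on \<Omega>))) \<le> hencky_energy \<mu> \<Lambda> \<Omega> u" for u
    unfolding hencky_energy_def using p by (intro ereal_integral_ge_Lp_norm M) auto
  then show "coercive_W1p p \<Omega> (hencky_energy \<mu> \<Lambda> \<Omega>)"
    \<comment> \<open>The constants are 1 and \<open>K\<close> times the measure of the
      domain.\<close>
    unfolding coercive_W1p_def by (intro exI[of _ 1] conjI exI) auto
qed

end
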